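(* Let $q\ge 1$ be an integer and let $T$ be an infinite $(q+1)$-homogeneous tree rooted at $o$. Let $X$ be either $\mathbb{T}_p$ or $\mathbb{T}_{p,0}$ with $\|\cdot\|_p$, where $0<p\le\infty$, and let $M_\psi\colon X\to X$ be a bounded multiplication operator on $X$, where $\psi\colon T\to\mathbb{C}$. Then $M_\psi$ is an isometry on $X$ if and only if $|\psi(v)|=1$ for all $v\in T$.
   Context: A $(q+1)$-homogeneous tree is a connected graph without cycles in which every vertex has exactly $q+1$ neighbours; rooted means that a vertex $o$ (the root) is singled out. For a vertex $v$, $|v|$ is the number of edges in the unique path from $o$ to $v$; for $n\ge1$ there are $(q+1)q^{n-1}$ vertices with $|v|=n$. Functions on $T$ are functions on its vertices, and $v\in T$ means $v$ is a vertex. $\mathbb{N}=\{1,2,\dots\}$, $\mathbb{N}_0=\mathbb{N}\cup\{0\}$. For $f\colon T\to\mathbb{C}$ and $n\in\mathbb{N}$, $M_p(n,f)=\left(\frac{1}{(q+1)q^{n-1}}\sum_{|v|=n}|f(v)|^p\right)^{1/p}$ if $0<p<\infty$, $M_\infty(n,f)=\max_{|v|=n}|f(v)|$, and $M_p(0,f)=|f(o)|$ for all $p\in(0,\infty]$. Put $\|f\|_p=\sup_{n\in\mathbb{N}_0}M_p(n,f)$, $\mathbb{T}_p=\{f\colon T\to\mathbb{C}:\|f\|_p<\infty\}$ and $\mathbb{T}_{p,0}=\{f\in\mathbb{T}_p:\lim_{n\to\infty}M_p(n,f)=0\}$. The multiplication operator with symbol $\psi$ is $M_\psi f=\psi f$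 (pointwise product); bounded on $X$ means it maps $X$ to $X$ and $\|\psi f\|_p\le C\|f\|_p$ for some constant $C$ and all $f\in X$. $M_\psi$ is an isometry on $X$ if $\|M_\psi f\|_p=\|f\|_p$ for all $f\in X$ (also when $0<p<1$). *)

theory Defs
  imports
    Complex_Main
    "HOL-Library.Extended_Real"
    "Graph_Theory.Graph_Theory"
begin

text \<open>
  An undirected simple graph, possibly infinite, is a symmetric loop-free digraph
  (\<open>pair_bidirected_digraph\<close>): the edge between \<open>u\<close> and \<open>v\<close> is the pair of arcs \<open>(u, v)\<close>, \<open>(v, u)\<close>.
  In such a digraph \<open>u, v, u\<close> is a cycle of length 2 in the sense of \<open>pre_digraph.cycle\<close>, so the
  library's \<open>forest\<close> and \<open>tree\<close> hold for no symmetric graph with an edge. The cycles of the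
  undirected graph are the cycles of length at least 3.
\<close>

definition undirected_tree :: "'a pair_pre_digraph \<Rightarrow> bool" where
  "undirected_tree T \<longleftrightarrow>
     pair_bidirected_digraph T \<and>
     Digraph_Component.connected (with_proj T) \<and>
     \<not> (\<exists>c. pre_digraph.cycle (with_proj T) c \<and> 3 \<le> length c)"

definition homogeneous_tree :: "nat \<Rightarrow> 'a pair_pre_digraph \<Rightarrow> bool" where
  "homogeneous_tree q T \<longleftrightarrow>
     undirected_tree T \<and> (\<forall>v\<in>pverts T. out_degree (with_proj T) v = q + 1)"

definition depth :: "'a pair_pre_digraph \<Rightarrow> 'a \<Rightarrow> 'a \<Rightarrow> nat" where
  "depth T r v = length (THE c. pre_digraph.apath (with_proj T) r c v)"

definition level :: "'a pair_pre_digraph \<Rightarrow> 'a \<Rightarrow> nat \<Rightarrow> 'a set" where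
  "level T r n = {v \<in> pverts T. depth T r v = n}"

text \<open>
  Functions on the tree are total functions on the vertex type \<open>'a\<close>; everything below depends only
  on their values on \<open>pverts T\<close>. The exponent \<open>p\<close> ranges over the extended reals, with
  \<open>0 < p \<le> \<infinity>\<close> intended.
\<close>

definition M_mean ::
    "nat \<Rightarrow> 'a pair_pre_digraph \<Rightarrow> 'a \<Rightarrow> ereal \<Rightarrow> nat \<Rightarrow> ('a \<Rightarrow> complex) \<Rightarrow> real" where
  "M_mean q T r p n f =
     (if n = 0 then cmod (f r)
      else if p = \<infinity> then Max ((\<lambda>v. cmod (f v)) ` level T r n)
      else (1 / ((real q + 1) * real q ^ (n - 1)) *
              (\<Sum>v\<in>level T r n. cmod (f v) powr real_of_ereal p)) powr (1 / real_of_ereal p))"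

definition T_norm ::
    "nat \<Rightarrow> 'a pair_pre_digraph \<Rightarrow> 'a \<Rightarrow> ereal \<Rightarrow> ('a \<Rightarrow> complex) \<Rightarrow> ereal" where
  "T_norm q T r p f = (SUP n. ereal (M_mean q T r p n f))"

definition T_space ::
    "nat \<Rightarrow> 'a pair_pre_digraph \<Rightarrow> 'a \<Rightarrow> ereal \<Rightarrow> ('a \<Rightarrow> complex) set" where
  "T_space q T r p = {f. T_norm q T r p f < \<infinity>}"

definition T_space0 ::
    "nat \<Rightarrow> 'a pair_pre_digraph \<Rightarrow> 'a \<Rightarrow> ereal \<Rightarrow> ('a \<Rightarrow> complex) set" where
  "T_space0 q T r p = {f \<in> T_space q T r p. (\<lambda>n. M_mean q T r p n f) \<longlonglongrightarrow> 0}"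

definition mult_op :: "('a \<Rightarrow> complex) \<Rightarrow> ('a \<Rightarrow> complex) \<Rightarrow> 'a \<Rightarrow> complex" where
  "mult_op \<psi> f = (\<lambda>v. \<psi> v * f v)"

definition bounded_operator_on ::
    "(('a \<Rightarrow> complex) \<Rightarrow> ereal) \<Rightarrow> ('a \<Rightarrow> complex) set \<Rightarrow>
     (('a \<Rightarrow> complex) \<Rightarrow> 'a \<Rightarrow> complex) \<Rightarrow> bool" where
  "bounded_operator_on N X A \<longleftrightarrow>
     (\<forall>f\<in>X. A f \<in> X) \<and> (\<exists>C::real. \<forall>f\<in>X. N (A f) \<le> ereal C * N f)"

definition isometry_operator_on ::
    "(('a \<Rightarrow> complex) \<Rightarrow> ereal) \<Rightarrow> ('a \<Rightarrow> complex) set \<Rightarrow>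
     (('a \<Rightarrow> complex) \<Rightarrow> 'a \<Rightarrow> complex) \<Rightarrow> bool" where
  "isometry_operator_on N X A \<longleftrightarrow> (\<forall>f\<in>X. N (A f) = N f)"

end

theory Submission
  imports Defs
begin

text \<open>
  Only the converse direction has content: testing the isometry on the indicator function of a
  vertex \<open>v\<close> gives \<open>|\<psi> v| K = K\<close>, where \<open>K > 0\<close> is the norm of the indicator function.
  The norm sees the indicator as it should because paths in a tree are unique and each level is
  finite and nonempty; otherwise \<open>Max\<close>, the sums and \<open>THE\<close> would take junk values.
\<close>

section \<open>Unique paths and depth\<close>

lemma undirected_tree_bidirected: "undirected_tree T \<Longrightarrow> pair_bidirected_digraph T"
  by (simp add: undirected_tree_def)

text \<open>A walk from \<open>x\<close> to \<open>y\<close> avoiding \<open>u\<close> shortens to a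
  path avoiding \<open>u\<close>; closing that path through \<open>u\<close> produces a cycle that a
  tree forbids.\<close>

lemma undirected_tree_no_bypass:
  assumes tree: "undirected_tree T"
    and arcs: "(u, x) \<in> parcs T" "(u, y) \<in> parcs T" and "x \<noteq> y"
    and walk: "pre_digraph.awalk (with_proj T) x p y"
  shows "u \<in> set (pre_digraph.awalk_verts (with_proj T) x p)"
proof (rule ccontr)
  interpret pair_bidirected_digraph T
    using tree by (rule undirected_tree_bidirected)
  assume u: "u \<notin> set (pre_digraph.awalk_verts (with_proj T) x p)"
  define s where "s = awalk_to_apath p"
  have path: "apath x s y" and sub: "set s \<subseteq> set p"
    using walk apath_awalk_to_apath awalk_to_apath_subset by (auto simp: s_def)
  have s: "awalk x s y" and dist: "distinct (awalk_verts x s)"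
    using path by (auto simp: apath_def)
  have "s \<noteq> []"
    using s \<open>x \<noteq> y\<close> by (auto simp: awalk_Nil_iff)
  have "set (awalk_verts x s) \<subseteq> set (awalk_verts x p)"
    using sub unfolding set_awalk_verts[OF s] set_awalk_verts[OF walk] by auto
  with u have u': "u \<notin> set (awalk_verts x s)"
    by auto
  have yu: "(y, u) \<in> parcs T"
    using arcs arcs_symmetric by simp
  then have last_arc: "awalk y [(y, u)] u"
    using arc_implies_awalk[of "(y, u)"] by simp
  have closed: "awalk x (s @ [(y, u)]) u"
    using s last_arc by (rule awalk_appendI)
  have "cycle ((u, x) # s @ [(y, u)])"
    unfolding cycle_def
  proof (intro exI conjI)
    show "awalk u ((u, x) # s @ [(y, u)]) u"
      using closed arcs by (simp add: awalk_Cons_iff del: awalk_append_iff)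
    have "awalk_verts x (s @ [(y, u)]) = awalk_verts x s @ [u]"
      unfolding awalk_verts_append[OF closed] by simp
    then show "distinct (tl (awalk_verts u ((u, x) # s @ [(y, u)])))"
      using dist u' by simp
  qed simp
  \<comment> \<open>The nonempty \<open>s\<close> supplies the third arc, so this is not the
    degenerate 2-cycle formed by an arc and its reverse.\<close>
  moreover have "3 \<le> length ((u, x) # s @ [(y, u)])"
    using \<open>s \<noteq> []\<close> by (cases s) auto
  ultimately show False
    using tree unfolding undirected_tree_def by blast
qed

text \<open>Compare first arcs: if they lead from \<open>u\<close> to \<open>x\<close> and
  \<open>y\<close>, then the rest of one path followed by the reversed rest of the other is a walk
  from \<open>x\<close> to \<open>y\<close> avoiding \<open>u\<close>. Hence \<open>x = y\<close>,
  and induction applies to the rests.\<close>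

lemma undirected_tree_apath_unique:
  assumes tree: "undirected_tree T"
    and "pre_digraph.apath (with_proj T) u p v" "pre_digraph.apath (with_proj T) u q v"
  shows "p = q"
  using assms(2,3)
proof (induction p arbitrary: u q)
  interpret pair_bidirected_digraph T
    using tree by (rule undirected_tree_bidirected)
  {
    case Nil
    then show ?case
      by (metis apath_Nil_iff apath_nonempty_ends)
  next
    case (Cons e p)
    obtain x where e: "e = (u, x)" "(u, x) \<in> parcs T" and p: "apath x p v"
      and up: "u \<notin> set (awalk_verts x p)"
      using Cons.prems(1) by (cases e) (auto simp: apath_Cons_iff)
    have "u \<noteq> v"
      using Cons.prems(1) apath_nonempty_ends by blast
    then obtain f q' where q: "q = f # q'"
      using Cons.prems(2) by (cases q) (auto simp: apath_Nil_iff)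
    obtain y where f: "f = (u, y)" "(u, y) \<in> parcs T" and q': "apath y q' v"
      and uq: "u \<notin> set (awalk_verts y q')"
      using Cons.prems(2) unfolding q by (cases f) (auto simp: apath_Cons_iff)
    have wp: "awalk x p v" and wq: "awalk y q' v"
      using p q' by (auto simp: apath_def)
    have wr: "awalk v (rev_path q') y"
      using wq by simp
    have walk: "awalk x (p @ rev_path q') y"
      using wp wr by (rule awalk_appendI)
    have "u \<notin> set (awalk_verts x (p @ rev_path q'))"
      unfolding set_awalk_verts_append[OF wp wr] awalk_verts_rev_path[OF wq]
      using up uq by simp
    then have "x = y"
      using undirected_tree_no_bypass[OF tree e(2) f(2) _ walk] by auto
    then show ?case
      using Cons.IH[OF p] q' q e f by simp
  }
qed

text \<open>By uniqueness of paths, the \<open>THE\<close> in \<open>depth\<close> denotes the given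
  path, so depth can be read off any path from \<open>r\<close>.\<close>

lemma depth_eqI:
  assumes "undirected_tree T" "pre_digraph.apath (with_proj T) r c v"
  shows "depth T r v = length c"
  unfolding depth_def using assms undirected_tree_apath_unique by (metis the_equality)

lemma undirected_tree_apath_exists:
  assumes tree: "undirected_tree T" and "r \<in> pverts T" "v \<in> pverts T"
  shows "\<exists>c. pre_digraph.apath (with_proj T) r c v \<and> length c = depth T r v"
proof -
  interpret pair_bidirected_digraph T
    using tree by (rule undirected_tree_bidirected)
  \<comment> \<open>Symmetry of the arcs upgrades connectedness to directed reachability.\<close>
  have "strongly_connected (with_proj T)"
    using tree symmetric_connected_imp_strongly_connected[OF sym_arcs]
    by (auto simp: undirected_tree_def)
  then have "r \<rightarrow>\<^sup>*\<^bsub>with_proj T\<^esub> v"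
    using assms by (auto simp: strongly_connected_def)
  then show ?thesis
    using depth_eqI[OF tree] by (fastforce simp: reachable_apath)
qed

section \<open>Levels are finite and nonempty\<close>

lemma level_0:
  assumes tree: "undirected_tree T" and "r \<in> pverts T"
  shows "level T r 0 = {r}"
proof -
  interpret pair_bidirected_digraph T
    using tree by (rule undirected_tree_bidirected)
  have "depth T r r = 0"
    using depth_eqI[OF tree, of r "[]" r] assms by (simp add: apath_Nil_iff)
  then show ?thesis
    using undirected_tree_apath_exists[OF assms] assms
    by (force simp: level_def apath_Nil_iff)
qed

text \<open>Deleting the last arc of the path from \<open>r\<close> to \<open>v\<close> leaves the
  path to the parent of \<open>v\<close>, one level up. Finiteness and emptiness of a level thus
  pass on to the next one.\<close>

lemma level_Suc_subset:
  assumes tree: "undirected_tree T" and "r \<in> pverts T"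
  shows "level T r (Suc n) \<subseteq> (\<Union>u\<in>level T r n. snd ` out_arcs (with_proj T) u)"
proof
  interpret pair_bidirected_digraph T
    using tree by (rule undirected_tree_bidirected)
  fix v assume "v \<in> level T r (Suc n)"
  then obtain c where c: "apath r c v" "length c = Suc n"
    using undirected_tree_apath_exists[OF assms] by (fastforce simp: level_def)
  then obtain d e where d: "c = d @ [e]"
    by (metis length_Suc_conv_rev)
  define u where "u = awlast r d"
  have ru: "apath r d u" and uv: "apath u [e] v"
    using c(1) unfolding d apath_append_iff u_def by auto
  have "u \<in> level T r n"
    using depth_eqI[OF tree ru] c(2) d ru by (auto simp: level_def apath_def)
  moreover have "e \<in> out_arcs (with_proj T) u" "snd e = v"
    using uv by (auto simp: apath_simps)
  ultimately show "v \<in> (\<Union>u\<in>level T r n. snd ` out_arcs (with_proj T) u)"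
    by blast
qed

lemma finite_level:
  assumes hom: "homogeneous_tree q T" and "r \<in> pverts T"
  shows "finite (level T r n)"
proof (induction n)
  case 0
  then show ?case
    using assms level_0 by (fastforce simp: homogeneous_tree_def)
next
  case (Suc n)
  \<comment> \<open>The cardinality of an infinite set is 0 by convention, so the out-degree
    \<open>q + 1\<close> forces finiteness.\<close>
  have "finite (out_arcs (with_proj T) u)" if "u \<in> level T r n" for u
  proof (rule card_ge_0_finite)
    show "0 < card (out_arcs (with_proj T) u)"
      using hom that by (auto simp: homogeneous_tree_def out_degree_def level_def)
  qed
  then have "finite (\<Union>u\<in>level T r n. snd ` out_arcs (with_proj T) u)"
    using Suc by blast
  then show ?case
    using level_Suc_subset[of T r n] assms finite_subset by (auto simp: homogeneous_tree_def)
qed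

text \<open>An empty level makes all later ones empty, so finitely many finite levels would cover an
  infinite vertex set.\<close>

lemma level_nonempty:
  assumes hom: "homogeneous_tree q T" and "r \<in> pverts T" and "infinite (pverts T)"
  shows "level T r n \<noteq> {}"
proof
  assume empty: "level T r n = {}"
  have "level T r m = {}" if "n \<le> m" for m
    using that
  proof (induction m rule: dec_induct)
    case (step m)
    then show ?case
      using level_Suc_subset[of T r m] assms by (auto simp: homogeneous_tree_def)
  qed (rule empty)
  then have "depth T r v < n" if "v \<in> pverts T" for v
    using that by (force simp: level_def not_le[symmetric])
  then have "pverts T \<subseteq> (\<Union>m<n. level T r m)"
    by (auto simp: level_def)
  then show False
    using finite_level[OF assms(1,2)] assms(3) finite_subset by blast
qed

section \<open>Means and norms of test functions\<close>

lemma M_mean_cong_cmod: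
  assumes "r \<in> pverts T" "\<And>v. v \<in> pverts T \<Longrightarrow> cmod (f v) = cmod (g v)"
  shows "M_mean q T r p n f = M_mean q T r p n g"
proof -
  have "cmod (f v) = cmod (g v)" if "v \<in> level T r n" for v
    using that assms(2) by (simp add: level_def)
  then have "(\<lambda>v. cmod (f v)) ` level T r n = (\<lambda>v. cmod (g v)) ` level T r n"
    "(\<Sum>v\<in>level T r n. cmod (f v) powr real_of_ereal p) =
      (\<Sum>v\<in>level T r n. cmod (g v) powr real_of_ereal p)"
    by (simp_all cong: image_cong sum.cong)
  then show ?thesis
    using assms by (simp add: M_mean_def)
qed

text \<open>The factor \<open>K\<close> is chosen before \<open>a\<close>, so the point masses at
  \<open>v\<close> with values 1 and \<open>\<psi> v\<close> share it and their norms can be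
  compared.\<close>

lemma M_mean_point_mass:
  assumes "1 \<le> q" "homogeneous_tree q T" "infinite (pverts T)" "r \<in> pverts T" "0 < p"
    and v: "v \<in> pverts T"
  obtains K where "0 < K"
    "\<And>a n. M_mean q T r p n (\<lambda>w. if w = v then a else 0) =
      (if n = depth T r v then cmod a * K else 0)"
proof -
  have tree: "undirected_tree T"
    using assms by (simp add: homogeneous_tree_def)
  define N where "N = depth T r v"
  have fin: "finite (level T r n)" and ne: "level T r n \<noteq> {}" for n
    using finite_level[OF assms(2,4)] level_nonempty[OF assms(2,4,3)] by auto
  have mem: "v \<in> level T r n \<longleftrightarrow> n = N" for n
    using v by (auto simp: level_def N_def)
  have root: "v = r \<longleftrightarrow> N = 0"
    using mem[of 0] level_0[OF tree assms(4)] by auto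
  define P where "P = real_of_ereal p"
  define A where "A n = 1 / ((real q + 1) * real q ^ (n - 1))" for n :: nat
  \<comment> \<open>On level \<open>N\<close> only one term survives, with weight
    \<open>A N\<close>, and the outer power turns this weight into \<open>A N powr (1 / P)\<close>.
    The root and the maximum carry no weight.\<close>
  define K where "K = (if N = 0 \<or> p = \<infinity> then 1 else A N powr (1 / P))"
  have A: "0 < A n" for n
    using assms(1) by (simp add: A_def)
  have K: "0 < K"
    using A[of N] by (simp add: K_def)
  have "M_mean q T r p n (\<lambda>w. if w = v then a else 0) = (if n = N then cmod a * K else 0)"
    (is "M_mean q T r p n ?f = _") for a n
  proof (cases "n = 0")
    case True
    then show ?thesis
      using root by (auto simp: M_mean_def K_def)
  next
    case n: False
    show ?thesis
    proof (cases "p = \<infinity>")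
      case True
      have "Max ((\<lambda>w. cmod (?f w)) ` level T r n) = (if n = N then cmod a else 0)"
      proof (rule Max_eqI)
        show "finite ((\<lambda>w. cmod (?f w)) ` level T r n)"
          using fin by simp
        show "y \<le> (if n = N then cmod a else 0)" if "y \<in> (\<lambda>w. cmod (?f w)) ` level T r n" for y
          using that mem[of n] by auto
        show "(if n = N then cmod a else 0) \<in> (\<lambda>w. cmod (?f w)) ` level T r n"
        proof (cases "n = N")
          case True
          then show ?thesis
            using mem[of n] by (intro image_eqI[of _ _ v]) auto
        next
          case False
          \<comment> \<open>Off level \<open>N\<close> the maximum 0 must be attained, which takes
            some vertex of that level.\<close>
          obtain w where "w \<in> level T r n"
            using ne by blast
          then show ?thesis
            using False mem[of n] by (intro image_eqI[of _ _ w]) auto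
        qed
      qed
      then show ?thesis
        using n True by (simp add: M_mean_def K_def)
    next
      case False
      then have P: "0 < P"
        using assms(5) by (cases p) (auto simp: P_def)
      have "(\<Sum>w\<in>level T r n. cmod (?f w) powr P) =
          (\<Sum>w\<in>level T r n. if w = v then cmod a powr P else 0)"
        by (intro sum.cong) auto
      also have "\<dots> = (if n = N then cmod a powr P else 0)"
        using fin mem by simp
      finally have "M_mean q T r p n ?f = (A n * (if n = N then cmod a powr P else 0)) powr (1 / P)"
        using n False by (simp add: M_mean_def A_def P_def)
      \<comment> \<open>On level \<open>N\<close> the exponents \<open>P\<close> and
        \<open>1 / P\<close> cancel since \<open>P > 0\<close>; elsewhere
        \<open>0 powr (1 / P)\<close> is 0.\<close>
      also have "\<dots> = (if n = N then cmod a * K else 0)"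
        using n False P A[of n] by (auto simp: K_def powr_mult powr_powr)
      finally show ?thesis .
    qed
  qed
  with K show ?thesis
    using that unfolding N_def by blast
qed

text \<open>Since \<open>0 \<le> c\<close>, the value on level \<open>N\<close> dominates the zeros
  elsewhere, so the supremum is attained there.\<close>

lemma T_norm_single_level:
  assumes "\<And>n. M_mean q T r p n f = (if n = N then c else 0)" "0 \<le> c"
  shows "T_norm q T r p f = ereal c"
  unfolding T_norm_def assms(1) using assms(2)
  by (intro antisym SUP_least SUP_upper2[of N]) auto

section \<open>The isometry criterion\<close>

theorem theorem10:
  fixes q :: nat
    and T :: "'a pair_pre_digraph"
    and r :: 'a
    and p :: ereal
    and X :: "('a \<Rightarrow> complex) set"
    and \<psi> :: "'a \<Rightarrow> complex"
  assumes "1 \<le> q"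
    and "homogeneous_tree q T"
    and "infinite (pverts T)"
    and "r \<in> pverts T"
    and "0 < p"
    and "X = T_space q T r p \<or> X = T_space0 q T r p"
    and "bounded_operator_on (T_norm q T r p) X (mult_op \<psi>)"
  shows "isometry_operator_on (T_norm q T r p) X (mult_op \<psi>) \<longleftrightarrow>
         (\<forall>v\<in>pverts T. cmod (\<psi> v) = 1)"
proof
  assume iso: "isometry_operator_on (T_norm q T r p) X (mult_op \<psi>)"
  show "\<forall>v\<in>pverts T. cmod (\<psi> v) = 1"
  proof
    fix v assume "v \<in> pverts T"
    then obtain K where K: "0 < K"
      "\<And>a n. M_mean q T r p n (\<lambda>w. if w = v then a else 0) =
        (if n = depth T r v then cmod a * K else 0)"
      using M_mean_point_mass assms(1-5) by metis
    have norm: "T_norm q T r p (\<lambda>w. if w = v then a else 0) = ereal (cmod a * K)" for a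
      using K by (intro T_norm_single_level) auto
    let ?f = "\<lambda>w. if w = v then 1 else 0 :: complex"
    \<comment> \<open>The means vanish beyond the depth of \<open>v\<close>, so the indicator lies
      in \<open>T_space0\<close> as well as in \<open>T_space\<close>, and both choices of
      \<open>X\<close> are covered.\<close>
    have "(\<lambda>n. M_mean q T r p n ?f) \<longlonglongrightarrow> 0"
      unfolding K(2)
      by (rule tendsto_eventually, rule eventually_sequentiallyI[of "Suc (depth T r v)"]) auto
    then have "?f \<in> X"
      using assms(6) norm[of 1] by (auto simp: T_space_def T_space0_def)
    then have "T_norm q T r p (mult_op \<psi> ?f) = T_norm q T r p ?f"
      using iso by (simp add: isometry_operator_on_def)
    moreover have "mult_op \<psi> ?f = (\<lambda>w. if w = v then \<psi> v else 0)"
      by (auto simp: mult_op_def)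
    ultimately show "cmod (\<psi> v) = 1"
      using norm[of "\<psi> v"] norm[of 1] K(1) by simp
  qed
next
  assume "\<forall>v\<in>pverts T. cmod (\<psi> v) = 1"
  \<comment> \<open>Multiplication by unimodular values keeps every modulus on the tree, so the
    means agree level by level and so do their suprema.\<close>
  then have "M_mean q T r p n (mult_op \<psi> f) = M_mean q T r p n f" for f n
    using assms(4) by (intro M_mean_cong_cmod) (auto simp: mult_op_def norm_mult)
  then show "isometry_operator_on (T_norm q T r p) X (mult_op \<psi>)"
    by (simp add: isometry_operator_on_def T_norm_def)
qed

end
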